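(* Each of the following four dimensional real Lie algebras admits generalized complex structures of type $0$ and of type $1$, but not of type $2$: $\mathbb R\times\mathfrak r_{3,-1}$, $\mathfrak r_{4,-1}$, $\mathfrak r_{4,0}$, $\mathfrak n_4$, $\mathfrak r_{4,\mu,-\mu}$ $(-1<\mu<0)$ and $\mathfrak r_{4,-1,\lambda}$ $(-1<\lambda<0)$.
   Context: The Lie algebras have basis $e_0,e_1,e_2,e_3$ and the following nonzero brackets (up to skew-symmetry): $\mathbb R\times\mathfrak r_{3,-1}$: $[e_1,e_2]=e_2$, $[e_1,e_3]=-e_3$. $\mathfrak r_{4,\lambda}$: $[e_0,e_1]=e_1$, $[e_0,e_2]=\lambda e_2$, $[e_0,e_3]=e_2+\lambda e_3$. $\mathfrak n_4$: $[e_0,e_1]=e_2$, $[e_0,e_2]=e_3$. $\mathfrak r_{4,\mu,\lambda}$: $[e_0,e_1]=e_1$, $[e_0,e_2]=\mu e_2$, $[e_0,e_3]=\lambda e_3$. A generalized complex structure on a real Lie algebra $\mathfrak g$ is an endomorphism $\mathcal J$ of $\mathfrak g\oplus\mathfrak g^*$ with $\mathcal J^2=-\mathrm{Id}$, orthogonal with respect to $\langle (x,\alpha),(y,\beta)\rangle=\frac12(\beta(x)+\alpha(y))$, and satisfying $[u,v]+\mathcal J[\mathcal Ju,v]+\mathcal J[u,\mathcal Jv]-[\mathcal Ju,\mathcal Jv]=0$ for all $u,v\in\mathfrak g\oplus\mathfrak g^*$, where $[(x,\alpha),(y,\beta)]=([x,y],-\beta\circ\mathrm{ad}(x)+\alpha\circ\mathrm{ad}(y))$.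 Write $\mathcal J=\begin{pmatrix}\mathcal J_1&\mathcal J_2\\ \mathcal J_3&\mathcal J_4\end{pmatrix}$ with respect to $\mathfrak g\oplus\mathfrak g^*$, so $\mathcal J_2:\mathfrak g^*\to\mathfrak g$. If $\dim\mathfrak g=2n$, $\mathcal J$ is of type $k$ when $\operatorname{rank}(\mathcal J_2)=2(n-k)$. *)

theory Defs
  imports "HOL-Analysis.Analysis"
begin

definition lie_bracket :: "('a::real_vector \<Rightarrow> 'a \<Rightarrow> 'a) \<Rightarrow> bool" where
  "lie_bracket br \<longleftrightarrow>
     bilinear br \<and> (\<forall>x. br x x = 0) \<and>
     (\<forall>x y z. br x (br y z) + br y (br z x) + br z (br x y) = 0)"

(* A real Lie algebra g is a Euclidean space 'a together with a Lie bracket br on it.  Only the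
   vector space structure of 'a is used: the dual space consists of the bounded linear functionals,
   which in finite dimension are all the linear functionals. *)

type_synonym 'a gtb = "'a \<times> ('a \<Rightarrow>\<^sub>L real)"

definition pairing :: "'a::euclidean_space gtb \<Rightarrow> 'a gtb \<Rightarrow> real" where
  "pairing u v = (1/2) * (blinfun_apply (snd v) (fst u) + blinfun_apply (snd u) (fst v))"

(* Blinfun returns the intended map when br x is linear, in particular for every Lie bracket. *)
definition ad :: "('a::euclidean_space \<Rightarrow> 'a \<Rightarrow> 'a) \<Rightarrow> 'a \<Rightarrow> ('a \<Rightarrow>\<^sub>L 'a)" where
  "ad br x = Blinfun (br x)"

definition gbracket ::
    "('a::euclidean_space \<Rightarrow> 'a \<Rightarrow> 'a) \<Rightarrow> 'a gtb \<Rightarrow> 'a gtb \<Rightarrow> 'a gtb" where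
  "gbracket br u v =
     (br (fst u) (fst v), - (snd v o\<^sub>L ad br (fst u)) + (snd u o\<^sub>L ad br (fst v)))"

definition generalized_complex_structure ::
    "('a::euclidean_space \<Rightarrow> 'a \<Rightarrow> 'a) \<Rightarrow> ('a gtb \<Rightarrow> 'a gtb) \<Rightarrow> bool" where
  "generalized_complex_structure br J \<longleftrightarrow>
     linear J \<and>
     (\<forall>u. J (J u) = - u) \<and>
     (\<forall>u v. pairing (J u) (J v) = pairing u v) \<and>
     (\<forall>u v. gbracket br u v + J (gbracket br (J u) v) + J (gbracket br u (J v))
              - gbracket br (J u) (J v) = 0)"

definition J2_block :: "('a::euclidean_space gtb \<Rightarrow> 'a gtb) \<Rightarrow> ('a \<Rightarrow>\<^sub>L real) \<Rightarrow> 'a" where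
  "J2_block J \<alpha> = fst (J (0, \<alpha>))"

(* The bound k \<le> n keeps the subtraction on the natural numbers from truncating. *)
definition of_type :: "('a::euclidean_space gtb \<Rightarrow> 'a gtb) \<Rightarrow> nat \<Rightarrow> bool" where
  "of_type J k \<longleftrightarrow>
     (\<exists>n. DIM('a) = 2 * n \<and> k \<le> n \<and> dim (range (J2_block J)) = 2 * (n - k))"

definition admits_gcs_of_type :: "('a::euclidean_space \<Rightarrow> 'a \<Rightarrow> 'a) \<Rightarrow> nat \<Rightarrow> bool" where
  "admits_gcs_of_type br k \<longleftrightarrow> (\<exists>J. generalized_complex_structure br J \<and> of_type J k)"

(* The four-dimensional Lie algebras live on real ^ 4.  The indices 0, 1, 2, 3 :: 4 are the four
   distinct elements of the index type (where 4 = 0).  A bracket is determined by its values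
   on pairs of basis vectors: bracket x y is the sum over i < j of minor i j x y *R [bas i, bas j]. *)

definition bas :: "4 \<Rightarrow> real ^ 4" where
  "bas i = axis i 1"

definition minor :: "4 \<Rightarrow> 4 \<Rightarrow> real ^ 4 \<Rightarrow> real ^ 4 \<Rightarrow> real" where
  "minor i j x y = x $ i * y $ j - x $ j * y $ i"

definition R_r3_minus1 :: "real ^ 4 \<Rightarrow> real ^ 4 \<Rightarrow> real ^ 4" where
  "R_r3_minus1 x y = minor 1 2 x y *\<^sub>R bas 2 + minor 1 3 x y *\<^sub>R (- bas 3)"

definition r4 :: "real \<Rightarrow> real ^ 4 \<Rightarrow> real ^ 4 \<Rightarrow> real ^ 4" where
  "r4 l x y = minor 0 1 x y *\<^sub>R bas 1 + minor 0 2 x y *\<^sub>R (l *\<^sub>R bas 2)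
     + minor 0 3 x y *\<^sub>R (bas 2 + l *\<^sub>R bas 3)"

definition n4 :: "real ^ 4 \<Rightarrow> real ^ 4 \<Rightarrow> real ^ 4" where
  "n4 x y = minor 0 1 x y *\<^sub>R bas 2 + minor 0 2 x y *\<^sub>R bas 3"

definition r4_diag :: "real \<Rightarrow> real \<Rightarrow> real ^ 4 \<Rightarrow> real ^ 4 \<Rightarrow> real ^ 4" where
  "r4_diag m l x y = minor 0 1 x y *\<^sub>R bas 1 + minor 0 2 x y *\<^sub>R (m *\<^sub>R bas 2)
     + minor 0 3 x y *\<^sub>R (l *\<^sub>R bas 3)"

lemma four_eq_zero: "(4::4) = 0"
  by simp

lemma index_4_distinct:
  "(0::4) \<noteq> 1" "(0::4) \<noteq> 2" "(0::4) \<noteq> 3" "(1::4) \<noteq> 2" "(1::4) \<noteq> 3" "(2::4) \<noteq> 3"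
  by simp_all

lemma forall_4_index: "(\<forall>i::4. P i) \<longleftrightarrow> P 0 \<and> P 1 \<and> P 2 \<and> P 3"
  using forall_4[of P] unfolding four_eq_zero by blast

lemmas bracket_defs = R_r3_minus1_def r4_def n4_def r4_diag_def minor_def bas_def axis_def

lemma lie_brackets:
  "lie_bracket R_r3_minus1" "lie_bracket (r4 l)" "lie_bracket n4" "lie_bracket (r4_diag m l)"
  unfolding lie_bracket_def bilinear_def
  by (auto intro!: linearI simp: bracket_defs vec_eq_iff forall_4_index
        index_4_distinct index_4_distinct[symmetric]) (simp_all add: algebra_simps)

end

theory Submission imports Defs begin

text \<open>
  Each algebra is a semidirect product of the line spanned by a basis vector \<open>a\<close> with an abelian
  ideal, on which \<open>a\<close> acts by a map \<open>D\<close> that is triangularizable over the reals and has only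
  one-dimensional eigenspaces.

  For a suitable order \<open>a, b, p, q\<close> of the basis, the form
  \<open>e\<^sup>a \<and> e\<^sup>b + e\<^sup>p \<and> e\<^sup>q\<close> is closed and gives a structure of type 0.  For another order, \<open>p\<close> and \<open>q\<close>
  span an abelian ideal on which \<open>a\<close> acts without trace and \<open>b\<close> acts trivially; a complex structure
  on the span of \<open>a, b\<close> and a symplectic form on the span of \<open>p, q\<close> combine to a structure of type 1.

  A structure of type 2 yields a complex structure \<open>J\<close> on the algebra.  The space \<open>H\<close> of all \<open>y\<close> in
  the abelian ideal such that \<open>J y\<close> is in the ideal as well is nonzero, and integrability shows that
  \<open>D\<close> preserves \<open>H\<close> and commutes with \<open>J\<close> there.  So \<open>D\<close> has an eigenvector \<open>y\<close> in \<open>H\<close>, and the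
  independent vectors \<open>y\<close> and \<open>J y\<close> are in the same eigenspace.
\<close>

section \<open>Coordinates in a reordered standard basis\<close>

lemma bas_nth [simp]: "bas i $ j = (if i = j then 1 else 0)"
  by (simp add: bas_def axis_def)

text \<open>A reordering of the basis lets one model structure serve algebras in which different
  basis vectors play its roles.\<close>

locale frame =
  fixes a b p q :: 4
  assumes distinct_frame: "distinct [a, b, p, q]"
begin

lemma UNIV_frame: "UNIV = {a, b, p, q}"
proof -
  have "card {a, b, p, q} = card (UNIV :: 4 set)"
    using distinct_frame by simp
  then show ?thesis
    by (metis card_subset_eq finite subset_UNIV)
qed

lemma all_frame: "(\<forall>i. P i) \<longleftrightarrow> P a \<and> P b \<and> P p \<and> P q"
  using UNIV_frame by (metis UNIV_I empty_iff insert_iff)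

lemma neq_frame [simp]:
  "a \<noteq> b" "a \<noteq> p" "a \<noteq> q" "b \<noteq> p" "b \<noteq> q" "p \<noteq> q"
  "b \<noteq> a" "p \<noteq> a" "q \<noteq> a" "p \<noteq> b" "q \<noteq> b" "q \<noteq> p"
  using distinct_frame by auto

lemma vec_expand: "x = x $ a *\<^sub>R bas a + x $ b *\<^sub>R bas b + x $ p *\<^sub>R bas p + x $ q *\<^sub>R bas q"
  by (simp add: vec_eq_iff all_frame)

lemma blinfun_expand:
  fixes \<alpha> :: "(real ^ 4) \<Rightarrow>\<^sub>L real"
  shows "\<alpha> x = x $ a * \<alpha> (bas a) + x $ b * \<alpha> (bas b) + x $ p * \<alpha> (bas p) + x $ q * \<alpha> (bas q)"
  by (subst vec_expand) (simp add: blinfun.add_right blinfun.scaleR_right)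

lemma gtb_eq_iff:
  fixes u v :: "(real ^ 4) gtb"
  shows "u = v \<longleftrightarrow> (\<forall>i. fst u $ i = fst v $ i \<and> snd u (bas i) = snd v (bas i))"
proof
  assume *: "\<forall>i. fst u $ i = fst v $ i \<and> snd u (bas i) = snd v (bas i)"
  have "snd u = snd v"
    by (rule blinfun_eqI) (metis blinfun_expand *)
  with * show "u = v"
    by (simp add: prod_eq_iff vec_eq_iff)
qed simp

lemma pairing_expand:
  "pairing v w = (1/2) *
     (fst v $ a * snd w (bas a) + fst v $ b * snd w (bas b) +
      fst v $ p * snd w (bas p) + fst v $ q * snd w (bas q) +
      fst w $ a * snd v (bas a) + fst w $ b * snd v (bas b) +
      fst w $ p * snd v (bas p) + fst w $ q * snd v (bas q))"
  unfolding pairing_def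
  by (subst blinfun_expand, subst (2) blinfun_expand) simp

definition covec :: "real \<Rightarrow> real \<Rightarrow> real \<Rightarrow> real \<Rightarrow> (real ^ 4) \<Rightarrow>\<^sub>L real" where
  "covec r s t u = blinfun_inner_right (r *\<^sub>R bas a + s *\<^sub>R bas b + t *\<^sub>R bas p + u *\<^sub>R bas q)"

lemma covec_apply: "covec r s t u x = r * x $ a + s * x $ b + t * x $ p + u * x $ q"
  by (simp add: covec_def inner_add_left bas_def inner_axis')

text \<open>When \<open>B\<close>, \<open>P\<close>, \<open>Q\<close> have no component along
  \<open>bas a\<close>, they are the images of \<open>bas b\<close>, \<open>bas p\<close>,
  \<open>bas q\<close> under the action of \<open>bas a\<close> on an abelian ideal.\<close>

definition ext :: "real ^ 4 \<Rightarrow> real ^ 4 \<Rightarrow> real ^ 4 \<Rightarrow> real ^ 4 \<Rightarrow> real ^ 4 \<Rightarrow> real ^ 4" where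
  "ext B P Q x y = minor a b x y *\<^sub>R B + minor a p x y *\<^sub>R P + minor a q x y *\<^sub>R Q"

lemma ad_ext: "ad (ext B P Q) x y = ext B P Q x y"
proof -
  have "linear (ext B P Q x)"
    by (rule linearI) (simp_all add: ext_def minor_def algebra_simps)
  then show ?thesis
    by (simp add: ad_def bounded_linear_Blinfun_apply linear_conv_bounded_linear)
qed

section \<open>Model structures of types 0 and 1\<close>

text \<open>With \<omega> = e^a \<and> e^b + e^p \<and> e^q read as the map from \<open>x\<close> to
  \<omega>(x, .), the off-diagonal blocks are \<omega> and minus its inverse.\<close>

definition J_symp :: "(real ^ 4) gtb \<Rightarrow> (real ^ 4) gtb" where
  "J_symp w =
     (- blinfun_apply (snd w) (bas b) *\<^sub>R bas a + blinfun_apply (snd w) (bas a) *\<^sub>R bas b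
       - blinfun_apply (snd w) (bas q) *\<^sub>R bas p + blinfun_apply (snd w) (bas p) *\<^sub>R bas q,
      covec (- fst w $ b) (fst w $ a) (- fst w $ q) (fst w $ p))"

text \<open>A quarter turn on the plane of \<open>bas a\<close>, \<open>bas b\<close> with its
  negative transpose on the dual plane, joined to the \<open>p\<close>, \<open>q\<close> part of
  \<open>J_symp\<close>.\<close>

definition J_mix :: "(real ^ 4) gtb \<Rightarrow> (real ^ 4) gtb" where
  "J_mix w = (- fst w $ b *\<^sub>R bas a + fst w $ a *\<^sub>R bas b
       - blinfun_apply (snd w) (bas q) *\<^sub>R bas p + blinfun_apply (snd w) (bas p) *\<^sub>R bas q,
      covec (- blinfun_apply (snd w) (bas b)) (blinfun_apply (snd w) (bas a))
        (- fst w $ q) (fst w $ p))"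

lemmas blinfun_arith = blinfun.add_right blinfun.diff_right blinfun.scaleR_right
  blinfun.minus_right blinfun.add_left blinfun.diff_left blinfun.minus_left blinfun.scaleR_left
  blinfun.zero_right

text \<open>The assumptions make \<omega> closed: \<open>B\<close> stays on its line and the
  \<open>p\<close>, \<open>q\<close> block is traceless. The entries \<open>g\<close>,
  \<open>h\<close> do not enter the differential, as \<open>bas b\<close> is \<omega>-orthogonal to
  \<open>bas p\<close> and \<open>bas q\<close>.\<close>

lemma gcs_J_symp:
  assumes B: "B = k *\<^sub>R bas b"
    and P: "P = s *\<^sub>R bas p + t *\<^sub>R bas q + g *\<^sub>R bas b"
    and Q: "Q = u *\<^sub>R bas p - s *\<^sub>R bas q + h *\<^sub>R bas b"
  shows "generalized_complex_structure (ext B P Q) J_symp"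
  unfolding generalized_complex_structure_def
proof (intro conjI allI)
  show "linear J_symp"
    by (rule linearI)
      (auto simp: J_symp_def gtb_eq_iff all_frame covec_apply blinfun_arith algebra_simps)
  show "J_symp (J_symp w) = - w" for w
    by (cases w) (simp add: J_symp_def gtb_eq_iff all_frame covec_apply blinfun_arith)
  show "pairing (J_symp v) (J_symp w) = pairing v w" for v w
    by (cases v; cases w) (simp add: J_symp_def pairing_expand covec_apply algebra_simps)
  show "gbracket (ext B P Q) v w + J_symp (gbracket (ext B P Q) (J_symp v) w)
      + J_symp (gbracket (ext B P Q) v (J_symp w))
      - gbracket (ext B P Q) (J_symp v) (J_symp w) = 0" for v w
    by (cases v; cases w)
      (simp add: J_symp_def gbracket_def gtb_eq_iff all_frame covec_apply
      blinfun_arith ad_ext ext_def minor_def B P Q,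
      simp add: algebra_simps)
qed

text \<open>The traceless block preserves e^p \<and> e^q. The entries \<open>g\<close>,
  \<open>h\<close> change its differential only by terms containing e^a \<and> e^b, which die when
  wedged with e^a or e^b.\<close>

lemma gcs_J_mix:
  assumes B: "B = k *\<^sub>R bas b + g *\<^sub>R bas p + h *\<^sub>R bas q"
    and P: "P = s *\<^sub>R bas p + t *\<^sub>R bas q"
    and Q: "Q = u *\<^sub>R bas p - s *\<^sub>R bas q"
  shows "generalized_complex_structure (ext B P Q) J_mix"
  unfolding generalized_complex_structure_def
proof (intro conjI allI)
  show "linear J_mix"
    by (rule linearI)
      (auto simp: J_mix_def gtb_eq_iff all_frame covec_apply blinfun_arith algebra_simps)
  show "J_mix (J_mix w) = - w" for w
    by (cases w) (simp add: J_mix_def gtb_eq_iff all_frame covec_apply blinfun_arith)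
  show "pairing (J_mix v) (J_mix w) = pairing v w" for v w
    by (cases v; cases w) (simp add: J_mix_def pairing_expand covec_apply algebra_simps)
  show "gbracket (ext B P Q) v w + J_mix (gbracket (ext B P Q) (J_mix v) w)
      + J_mix (gbracket (ext B P Q) v (J_mix w))
      - gbracket (ext B P Q) (J_mix v) (J_mix w) = 0" for v w
    by (cases v; cases w)
      (simp add: J_mix_def gbracket_def gtb_eq_iff all_frame covec_apply
      blinfun_arith ad_ext ext_def minor_def B P Q,
      simp add: algebra_simps)
qed

lemma J_symp_type: "of_type J_symp 0"
proof -
  \<comment> \<open>The preimage is -\<omega>(x, .), because the block is minus the inverse of
    \<omega>.\<close>
  have "x = J2_block J_symp (covec (x $ b) (- x $ a) (x $ q) (- x $ p))" for x
    by (simp add: J2_block_def J_symp_def covec_apply vec_eq_iff all_frame)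
  then have "range (J2_block J_symp) = UNIV"
    by (metis UNIV_eq_I rangeI)
  then show ?thesis
    unfolding of_type_def by (intro exI[of _ 2]) simp
qed

lemma J_mix_type: "of_type J_mix 1"
proof -
  have "range (J2_block J_mix) = span {bas p, bas q}"
  proof
    show "range (J2_block J_mix) \<subseteq> span {bas p, bas q}"
      by (intro image_subsetI, simp add: J2_block_def J_mix_def,
          intro span_add span_diff span_scale span_base) auto
    have "x *\<^sub>R bas p + y *\<^sub>R bas q = J2_block J_mix (covec 0 0 y (- x))" for x y
      by (simp add: J2_block_def J_mix_def covec_apply vec_eq_iff all_frame)
    then show "span {bas p, bas q} \<subseteq> range (J2_block J_mix)"
      by (auto simp: span_insert algebra_simps)
  qed
  moreover have "independent {bas p, bas q}"
    by (rule independent_mono[OF independent_Basis]) (auto simp: bas_def axis_in_Basis_iff)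
  moreover have "bas p \<noteq> bas q"
    by (auto simp: vec_eq_iff all_frame)
  ultimately have "dim (range (J2_block J_mix)) = 2"
    by (simp add: dim_span dim_eq_card_independent)
  then show ?thesis
    unfolding of_type_def by (intro exI[of _ 2]) simp
qed

lemma admits_type_0:
  assumes "br = ext (k *\<^sub>R bas b) (s *\<^sub>R bas p + t *\<^sub>R bas q + g *\<^sub>R bas b)
    (u *\<^sub>R bas p - s *\<^sub>R bas q + h *\<^sub>R bas b)"
  shows "admits_gcs_of_type br 0"
  using gcs_J_symp[OF refl refl refl] J_symp_type unfolding admits_gcs_of_type_def assms by blast

lemma admits_type_1:
  assumes "br = ext (k *\<^sub>R bas b + g *\<^sub>R bas p + h *\<^sub>R bas q) (s *\<^sub>R bas p + t *\<^sub>R bas q)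
    (u *\<^sub>R bas p - s *\<^sub>R bas q)"
  shows "admits_gcs_of_type br 1"
  using gcs_J_mix[OF refl refl refl] J_mix_type unfolding admits_gcs_of_type_def assms by blast

end

section \<open>Obstruction to type 2\<close>

text \<open>Type 2 in dimension four forces the block \<open>J2_block J\<close> to vanish. Then
  first components of \<open>J\<close> depend only on first components, and projecting the
  identities leaves an ordinary complex structure.\<close>

lemma not_type_2I:
  fixes br :: "real ^ 4 \<Rightarrow> real ^ 4 \<Rightarrow> real ^ 4"
  assumes no: "\<And>J. linear J \<Longrightarrow> (\<And>x. J (J x) = - x) \<Longrightarrow>
      (\<And>x y. br x y + J (br (J x) y) + J (br x (J y)) - br (J x) (J y) = 0) \<Longrightarrow> False"
  shows "\<not> admits_gcs_of_type br 2"
proof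
  assume "admits_gcs_of_type br 2"
  then obtain J where J: "generalized_complex_structure br J" "of_type J 2"
    by (auto simp: admits_gcs_of_type_def)
  have lin: "linear J" and sq: "\<And>u. J (J u) = - u"
    and nij: "\<And>u v. gbracket br u v + J (gbracket br (J u) v) + J (gbracket br u (J v))
              - gbracket br (J u) (J v) = 0"
    using J(1) by (auto simp: generalized_complex_structure_def)
  have "dim (range (J2_block J)) = 0"
    using J(2) by (auto simp: of_type_def)
  then have J2: "fst (J (0, \<alpha>)) = 0" for \<alpha>
    by (auto simp: dim_eq_0 J2_block_def)
  define I where "I x = fst (J (x, 0))" for x
  have fst_J: "fst (J w) = I (fst w)" for w
  proof -
    have "J w = J (fst w, 0) + J (0, snd w)"
      by (simp flip: linear_add[OF lin])
    then show ?thesis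
      by (simp add: J2 I_def)
  qed
  show False
  proof (rule no)
    show "linear I"
    proof (rule linearI)
      show "I (x + y) = I x + I y" for x y
        using linear_add[OF lin, of "(x, 0)" "(y, 0)"] by (simp add: I_def)
      show "I (r *\<^sub>R x) = r *\<^sub>R I x" for r x
        using linear_scale[OF lin, of r "(x, 0)"] by (simp add: I_def)
    qed
    show "I (I x) = - x" for x
      using arg_cong[OF sq[of "(x, 0)"], of fst] by (simp add: fst_J)
    show "br x y + I (br (I x) y) + I (br x (I y)) - br (I x) (I y) = 0" for x y
      using arg_cong[OF nij[of "(x, 0)" "(y, 0)"], of fst]
      by (simp add: fst_J gbracket_def)
  qed
qed


text \<open>The vanishing condition on the coordinate \<open>ix k\<close> expresses that the \<open>k\<close>-eigenspace of \<open>D\<close> on the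
  ideal has dimension at most one.\<close>

lemma not_type_2:
  fixes br :: "real ^ 4 \<Rightarrow> real ^ 4 \<Rightarrow> real ^ 4"
  assumes lie: "lie_bracket br"
    and ideal: "\<And>x y. br x y $ a = 0"
    and abelian: "\<And>x y. x $ a = 0 \<Longrightarrow> y $ a = 0 \<Longrightarrow> br x y = 0"
    and split: "\<And>x. x $ a = 0 \<Longrightarrow> D (D (D x - l *\<^sub>R x) - m *\<^sub>R (D x - l *\<^sub>R x))
                  = n *\<^sub>R (D (D x - l *\<^sub>R x) - m *\<^sub>R (D x - l *\<^sub>R x))"
    and simple: "\<And>k x. k \<in> {l, m, n} \<Longrightarrow> x $ a = 0 \<Longrightarrow> D x = k *\<^sub>R x \<Longrightarrow> x $ ix k = 0
                  \<Longrightarrow> x = 0"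
    and D: "D = br (bas a)"
  shows "\<not> admits_gcs_of_type br 2"
proof (rule not_type_2I)
  fix J
  assume J: "linear J" "\<And>x. J (J x) = - x"
    and nij: "\<And>x y. br x y + J (br (J x) y) + J (br x (J y)) - br (J x) (J y) = 0"
  have bil: "bilinear br"
    using lie by (simp add: lie_bracket_def)
  have linD: "linear D"
    using bil by (simp add: D bilinear_def)
  note lins = linear_add[OF J(1)] linear_diff[OF J(1)] linear_scale[OF J(1)]
    linear_add[OF linD] linear_diff[OF linD] linear_scale[OF linD]
    linear_neg[OF linD] linear_neg[OF J(1)] linear_0[OF J(1)]
  have D_ideal: "D x $ a = 0" for x
    by (simp add: D ideal)
  have br_D: "br x y = x $ a *\<^sub>R D y" if "y $ a = 0" for x y
  proof -
    have "br x y = br (x $ a *\<^sub>R bas a + (x - x $ a *\<^sub>R bas a)) y"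
      by simp
    also have "\<dots> = x $ a *\<^sub>R D y + br (x - x $ a *\<^sub>R bas a) y"
      by (simp only: bilinear_ladd[OF bil] bilinear_lmul[OF bil] D)
    also have "br (x - x $ a *\<^sub>R bas a) y = 0"
      by (rule abelian) (use that in auto)
    finally show ?thesis by simp
  qed
  \<comment> \<open>Otherwise \<open>J\<close> would preserve the ideal and act on the
    one-dimensional quotient by a real \<open>r\<close> with square -1.\<close>
  obtain c where c: "c $ a = 0" "J c $ a \<noteq> 0"
  proof (rule ccontr)
    assume "\<not> thesis"
    then have inv: "J x $ a = 0" if "x $ a = 0" for x
      using that \<open>\<And>c. c $ a = 0 \<Longrightarrow> J c $ a \<noteq> 0 \<Longrightarrow> thesis\<close> by blast
    define r where "r = J (bas a) $ a"
    have "J (J (bas a) - r *\<^sub>R bas a) $ a = 0"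
      by (rule inv) (simp add: r_def)
    then have "r * r = -1"
      by (simp add: lins J(2) r_def)
    then show False
      by (metis zero_le_square not_one_le_zero neg_0_le_iff_le)
  qed
  have comm: "J (D y) = D (J y)" if y: "y $ a = 0" "J y $ a = 0" for y
  proof -
    \<comment> \<open>Since \<open>J (J c) = - c\<close> lies in the abelian ideal with
      \<open>y\<close> and \<open>J y\<close>, two of the four terms vanish.\<close>
    have "br (J c) y + J (br (J (J c)) y) + J (br (J c) (J y)) - br (J (J c)) (J y) = 0"
      by (rule nij)
    then have "J c $ a *\<^sub>R (D y + J (D (J y))) = 0"
      using c y by (simp add: br_D J(2) lins scaleR_add_right)
    then have "D y + J (D (J y)) = 0"
      using c by simp
    then have "J (D y + J (D (J y))) = 0"
      by (simp add: linear_0[OF J(1)])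
    then show ?thesis
      by (simp add: lins J(2))
  qed
  define H where "H = {y. y $ a = 0 \<and> J y $ a = 0}"
  have D_H: "D y \<in> H" if "y \<in> H" for y
    using that D_ideal comm[of y] by (simp add: H_def)
  have shift_H: "D y - k *\<^sub>R y \<in> H" if "y \<in> H" for y k
    using D_H[OF that] that by (simp add: H_def lins)
  have no_eigenvector: "y = 0" if y: "y \<in> H" "D y = k *\<^sub>R y" and k: "k \<in> {l, m, n}" for y k
  proof (rule ccontr)
    assume "y \<noteq> 0"
    define i where "i = ix k"
    have i: "x = 0" if "x $ a = 0" "D x = k *\<^sub>R x" "x $ i = 0" for x
      using simple[OF k] that by (simp add: i_def)
    have yi: "y $ i \<noteq> 0"
      using i[of y] y \<open>y \<noteq> 0\<close> by (auto simp: H_def)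
    have DJ: "D (J y) = k *\<^sub>R J y"
      using comm[of y] y by (simp add: H_def lins)
    \<comment> \<open>The coefficient cancels coordinate \<open>i\<close>, so this eigenvector must
      be zero.\<close>
    have "J y - (J y $ i / y $ i) *\<^sub>R y = 0"
      by (rule i) (use y yi DJ in \<open>auto simp: H_def lins algebra_simps\<close>)
    then obtain r where r: "J y = r *\<^sub>R y"
      by (metis eq_iff_diff_eq_0)
    have "- y = (r * r) *\<^sub>R y"
      using J(2)[of y] by (simp add: r lins)
    then have "(r * r + 1) *\<^sub>R y = 0"
      by (metis add.left_inverse scaleR_add_left scaleR_one)
    then have "r * r + 1 = 0"
      using \<open>y \<noteq> 0\<close> by simp
    then show False
      by (metis add_pos_nonneg add.commute zero_le_square zero_less_one less_irrefl)
  qed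
  \<comment> \<open>\<open>H\<close> is the kernel of a linear map from dimension four to dimension
    two.\<close>
  have "\<not> inj (\<lambda>y. (y $ a, J y $ a))"
  proof
    assume "inj (\<lambda>y. (y $ a, J y $ a))"
    moreover have lin: "linear (\<lambda>y. (y $ a, J y $ a))"
      by (rule linearI) (simp_all add: lins)
    ultimately have "dim (range (\<lambda>y. (y $ a, J y $ a))) = dim (UNIV :: (real ^ 4) set)"
      by (intro dim_image_eq) auto
    moreover have "dim (range (\<lambda>y. (y $ a, J y $ a))) \<le> DIM(real \<times> real)"
      by (rule dim_subset_UNIV)
    ultimately show False by simp
  qed
  moreover have "linear (\<lambda>y. (y $ a, J y $ a))"
    by (rule linearI) (simp_all add: lins)
  ultimately obtain y where y: "y \<in> H" "y \<noteq> 0"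
    by (auto simp: linear_injective_0 H_def zero_prod_def)
  \<comment> \<open>The product of \<open>D - n\<close>, \<open>D - m\<close>, \<open>D - l\<close>
    kills the ideal. Its factors are peeled off one at a time, each leaving an eigenvector in
    \<open>H\<close>.\<close>
  define y1 where "y1 = D y - l *\<^sub>R y"
  define y2 where "y2 = D y1 - m *\<^sub>R y1"
  have H: "y1 \<in> H" "y2 \<in> H"
    using y shift_H by (auto simp: y1_def y2_def)
  have "D y2 = n *\<^sub>R y2"
    using split[of y] y by (simp add: y1_def y2_def H_def)
  then have "y2 = 0"
    using no_eigenvector H by blast
  then have "D y1 = m *\<^sub>R y1"
    by (simp add: y2_def)
  then have "y1 = 0"
    using no_eigenvector H by blast
  then have "D y = l *\<^sub>R y"
    by (simp add: y1_def)
  then show False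
    using no_eigenvector y by blast
qed

section \<open>Structures of types 0 and 1 on each algebra\<close>

lemma frames: "frame 0 1 2 3" "frame 0 2 1 3" "frame 0 3 1 2" "frame 1 0 2 3"
  by (simp_all add: frame_def)

lemmas ext_simps = frames[THEN frame.ext_def] minor_def vec_eq_iff forall_4_index fun_eq_iff

lemma R_r3_minus1_admits: "admits_gcs_of_type R_r3_minus1 0" "admits_gcs_of_type R_r3_minus1 1"
proof -
  show "admits_gcs_of_type R_r3_minus1 0"
    \<comment> \<open>After the frame and the bracket come \<open>k s t g u h\<close>, for type 1
      \<open>k g h s t u\<close>. Here the central \<open>bas 0\<close> serves as
      \<open>bas b\<close>.\<close>
    by (rule frame.admits_type_0[of 1 0 2 3 _ 0 1 0 0 0 0])
      (simp_all add: frames R_r3_minus1_def ext_simps)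
  show "admits_gcs_of_type R_r3_minus1 1"
    by (rule frame.admits_type_1[of 1 0 2 3 _ 0 0 0 1 0 0])
      (simp_all add: frames R_r3_minus1_def ext_simps)
qed

text \<open>Eigenvalues 1 and -1 go to \<open>p\<close> and \<open>q\<close>. The Jordan entry must
  point into \<open>b\<close> for type 0 and out of \<open>b\<close> for type 1, so 2 and 3 trade
  places.\<close>

lemma r4_minus1_admits: "admits_gcs_of_type (r4 (-1)) 0" "admits_gcs_of_type (r4 (-1)) 1"
proof -
  show "admits_gcs_of_type (r4 (-1)) 0"
    by (rule frame.admits_type_0[of 0 2 1 3 _ "-1" 1 0 0 0 1])
      (simp_all add: frames r4_def ext_simps)
  show "admits_gcs_of_type (r4 (-1)) 1"
    by (rule frame.admits_type_1[of 0 3 1 2 _ "-1" 0 1 1 0 0])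
      (simp_all add: frames r4_def ext_simps)
qed

lemma r4_0_admits: "admits_gcs_of_type (r4 0) 0" "admits_gcs_of_type (r4 0) 1"
proof -
  show "admits_gcs_of_type (r4 0) 0"
    by (rule frame.admits_type_0[of 0 1 2 3 _ 1 0 0 0 1 0])
      (simp_all add: frames r4_def ext_simps)
  show "admits_gcs_of_type (r4 0) 1"
    by (rule frame.admits_type_1[of 0 1 2 3 _ 1 0 0 0 0 1])
      (simp_all add: frames r4_def ext_simps)
qed

text \<open>The chain from \<open>bas 1\<close> through \<open>bas 2\<close> to \<open>bas 3\<close>
  ends at \<open>b\<close> for type 0 and starts at \<open>b\<close> for type 1.\<close>

lemma n4_admits: "admits_gcs_of_type n4 0" "admits_gcs_of_type n4 1"
proof -
  show "admits_gcs_of_type n4 0"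
    by (rule frame.admits_type_0[of 0 3 1 2 _ 0 0 1 0 0 1])
      (simp_all add: frames n4_def ext_simps)
  show "admits_gcs_of_type n4 1"
    by (rule frame.admits_type_1[of 0 1 2 3 _ 0 1 0 0 1 0])
      (simp_all add: frames n4_def ext_simps)
qed

lemma r4_diag_opposite_admits:
  "admits_gcs_of_type (r4_diag m (- m)) 0" "admits_gcs_of_type (r4_diag m (- m)) 1"
proof -
  show "admits_gcs_of_type (r4_diag m (- m)) 0"
    by (rule frame.admits_type_0[of 0 1 2 3 _ 1 m 0 0 0 0])
      (simp_all add: frames r4_diag_def ext_simps)
  show "admits_gcs_of_type (r4_diag m (- m)) 1"
    by (rule frame.admits_type_1[of 0 1 2 3 _ 1 0 0 m 0 0])
      (simp_all add: frames r4_diag_def ext_simps)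
qed

lemma r4_diag_minus1_admits:
  "admits_gcs_of_type (r4_diag (-1) l) 0" "admits_gcs_of_type (r4_diag (-1) l) 1"
proof -
  show "admits_gcs_of_type (r4_diag (-1) l) 0"
    by (rule frame.admits_type_0[of 0 3 1 2 _ l 1 0 0 0 0])
      (simp_all add: frames r4_diag_def ext_simps)
  show "admits_gcs_of_type (r4_diag (-1) l) 1"
    by (rule frame.admits_type_1[of 0 3 1 2 _ l 0 0 1 0 0])
      (simp_all add: frames r4_diag_def ext_simps)
qed

section \<open>Exclusion of type 2 for each algebra\<close>

lemma R_r3_minus1_not_type_2: "\<not> admits_gcs_of_type R_r3_minus1 2"
proof (rule not_type_2[where a = 1 and l = 0 and m = 1 and n = "-1"
      and D = "\<lambda>x. x $ 2 *\<^sub>R bas 2 - x $ 3 *\<^sub>R bas 3"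
      and ix = "\<lambda>k. if k = 0 then 0 else if k = 1 then 2 else 3"])
  show "x = 0"
    if "k \<in> {0, 1, -1}" "x $ 1 = 0" "x $ 2 *\<^sub>R bas 2 - x $ 3 *\<^sub>R bas 3 = k *\<^sub>R x"
      "x $ (if k = 0 then 0 else if k = 1 then 2 else 3) = 0" for k x
    using that by (auto simp: vec_eq_iff forall_4_index split: if_splits)
qed (simp_all add: lie_brackets R_r3_minus1_def minor_def vec_eq_iff forall_4_index fun_eq_iff
    algebra_simps)

text \<open>The eigenvalue \<open>l\<close> occurs twice, in a Jordan block whose only eigenline is
  that of \<open>bas 2\<close>; for \<open>l = 1\<close> it would be joined by
  \<open>bas 1\<close>.\<close>

lemma r4_not_type_2:
  assumes "l \<noteq> 1"
  shows "\<not> admits_gcs_of_type (r4 l) 2"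
proof (rule not_type_2[where a = 0 and l = 1 and m = l and n = l
      and D = "\<lambda>x. x $ 1 *\<^sub>R bas 1 + (l * x $ 2 + x $ 3) *\<^sub>R bas 2 + (l * x $ 3) *\<^sub>R bas 3"
      and ix = "\<lambda>k. if k = 1 then 1 else 2"])
  show "x = 0"
    if "k \<in> {1, l, l}" "x $ 0 = 0"
      "x $ 1 *\<^sub>R bas 1 + (l * x $ 2 + x $ 3) *\<^sub>R bas 2 + (l * x $ 3) *\<^sub>R bas 3 = k *\<^sub>R x"
      "x $ (if k = 1 then 1 else 2) = 0" for k x
    using assms that by (auto simp: vec_eq_iff forall_4_index split: if_splits)
qed (simp_all add: lie_brackets r4_def minor_def vec_eq_iff forall_4_index fun_eq_iff
    algebra_simps)

text \<open>\<open>D\<close> is nilpotent on the ideal, with kernel there spanned by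
  \<open>bas 3\<close>.\<close>

lemma n4_not_type_2: "\<not> admits_gcs_of_type n4 2"
proof (rule not_type_2[where a = 0 and l = 0 and m = 0 and n = 0
      and D = "\<lambda>x. x $ 1 *\<^sub>R bas 2 + x $ 2 *\<^sub>R bas 3"
      and ix = "\<lambda>k. 3"])
  show "x = 0"
    if "k \<in> {0, 0, 0}" "x $ 0 = 0"
      "x $ 1 *\<^sub>R bas 2 + x $ 2 *\<^sub>R bas 3 = k *\<^sub>R x"
      "x $ (3) = 0" for k x
    using that by (auto simp: vec_eq_iff forall_4_index split: if_splits)
qed (simp_all add: lie_brackets n4_def minor_def vec_eq_iff forall_4_index fun_eq_iff
    algebra_simps)

text \<open>Three distinct eigenvalues leave only the coordinate lines as eigenspaces in the
  ideal.\<close>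

lemma r4_diag_not_type_2:
  assumes "m \<noteq> 1" "l \<noteq> 1" "m \<noteq> l"
  shows "\<not> admits_gcs_of_type (r4_diag m l) 2"
proof (rule not_type_2[where a = 0 and l = 1 and m = m and n = l
      and D = "\<lambda>x. x $ 1 *\<^sub>R bas 1 + (m * x $ 2) *\<^sub>R bas 2 + (l * x $ 3) *\<^sub>R bas 3"
      and ix = "\<lambda>k. if k = 1 then 1 else if k = m then 2 else 3"])
  show "x = 0"
    if "k \<in> {1, m, l}" "x $ 0 = 0"
      "x $ 1 *\<^sub>R bas 1 + (m * x $ 2) *\<^sub>R bas 2 + (l * x $ 3) *\<^sub>R bas 3 = k *\<^sub>R x"
      "x $ (if k = 1 then 1 else if k = m then 2 else 3) = 0" for k x
    using assms that by (auto simp: vec_eq_iff forall_4_index split: if_splits)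
qed (simp_all add: lie_brackets r4_diag_def minor_def vec_eq_iff forall_4_index fun_eq_iff
    algebra_simps)

theorem proposition5p2:
  "\<forall>br \<in> {R_r3_minus1, r4 (-1), r4 0, n4}
         \<union> {r4_diag m (- m) | m. -1 < m \<and> m < 0}
         \<union> {r4_diag (-1) l | l. -1 < l \<and> l < 0}.
     admits_gcs_of_type br 0 \<and> admits_gcs_of_type br 1 \<and> \<not> admits_gcs_of_type br 2"
  using R_r3_minus1_admits R_r3_minus1_not_type_2 r4_minus1_admits r4_0_admits r4_not_type_2
    n4_admits n4_not_type_2 r4_diag_opposite_admits r4_diag_minus1_admits r4_diag_not_type_2
  by auto

end
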